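(* A subset $S\subseteq\mathbb{N}$ is of the form $H_f(P)$ for some graph $G$ and some vertex $P\in V(G)$ if and only if $S$ is an additive submonoid of $\mathbb{N}$. Moreover, $S$ is of the form $H_f(P)$ for some simple graph $G$ and some vertex $P\in V(G)$ if and only if $S$ is a numerical semigroup.
   Context: A graph is a finite connected multigraph with no loop edges; a simple graph is a graph with no multiple edges and more than one vertex. $\mathbb{N}=\{0,1,2,\dots\}$. A numerical semigroup is an additive submonoid of $\mathbb{N}$ with finite complement in $\mathbb{N}$. Let $\mathcal{M}(G)$ be the set of functions $V(G)\to\mathbb{Z}$; the Laplacian of $f$ is the divisor (integer vector indexed by vertices) $\Delta f$ with $\Delta f(Q)=\sum_{e=QR\in E(G)}(f(Q)-f(R))$, sum over edges incident to $Q$ counted with multiplicity. For $P\in V(G)$, the functional Weierstrass set is $H_f(P)=\{n\in\mathbb{N}:\exists f\in\mathcal{M}(G)\text{ with }\Delta f(P)=-n\text{ and }\Delta f(Q)\ge 0\ \forall Q\neq P\}$. *)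

theory Defs
  imports Main "HOL-Library.Multiset" "HOL-Library.Infinite_Typeclass"
begin

text \<open>A multigraph is given by its vertex set and the multiset of its edges, an edge being
  the two-element set of its endpoints (so there are no loops). Parallel edges are repeated
  members of the multiset.\<close>

locale multigraph =
  fixes V :: "'v set" and E :: "'v set multiset"
  assumes finite_verts: "finite V"
    and verts_nonempty: "V \<noteq> {}"
    and edge_endpoints: "e \<in># E \<Longrightarrow> e \<subseteq> V \<and> card e = 2"
    and connected: "u \<in> V \<Longrightarrow> w \<in> V \<Longrightarrow> (u, w) \<in> {(x, y). {x, y} \<in># E}\<^sup>*"

locale simple_graph = multigraph +
  assumes no_multiple_edges: "count E e \<le> 1"
    and more_than_one_vertex: "card V > 1"

text \<open>For an edge \<open>e\<close> at \<open>Q\<close>, the inner sum has exactly one summand: \<open>e - {Q}\<close>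
  consists of the other endpoint of \<open>e\<close>.\<close>

definition laplacian :: "'v set multiset \<Rightarrow> ('v \<Rightarrow> int) \<Rightarrow> 'v \<Rightarrow> int" where
  "laplacian E f Q = (\<Sum>e\<in>#{#e \<in># E. Q \<in> e#}. \<Sum>R\<in>e - {Q}. f Q - f R)"

text \<open>A function on the vertices is represented by a total function; its values outside \<open>V\<close>
  do not affect the Laplacian at vertices.\<close>

definition weierstrass_set :: "'v set \<Rightarrow> 'v set multiset \<Rightarrow> 'v \<Rightarrow> nat set" where
  "weierstrass_set V E P =
     {n. \<exists>f. laplacian E f P = - int n \<and> (\<forall>Q\<in>V - {P}. laplacian E f Q \<ge> 0)}"

definition additive_submonoid :: "nat set \<Rightarrow> bool" where
  "additive_submonoid S \<longleftrightarrow> 0 \<in> S \<and> (\<forall>a\<in>S. \<forall>b\<in>S. a + b \<in> S)"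

definition numerical_semigroup :: "nat set \<Rightarrow> bool" where
  "numerical_semigroup S \<longleftrightarrow> additive_submonoid S \<and> finite (- S)"

end

theory Submission
  imports Defs "HOL-Library.Nat_Bijection"
begin

text \<open>In a simple graph there is a function with positive Laplacian at every vertex other than
  \<open>P\<close>; its large multiples can be perturbed by the indicator of a neighbour of \<open>P\<close>, which
  changes the value at \<open>P\<close> by 1, so all large integers are attained.

  Conversely, gluing graphs at \<open>P\<close> adds their Weierstrass sets, so it suffices to realize one
  generator \<open>a\<close> of \<open>S\<close> at a time. A single vertex joined to \<open>P\<close> by \<open>a\<close> edges contributes
  exactly the multiples of \<open>a\<close>. In the simple case this vertex is replaced by a large complete
  graph, \<open>a\<close> of whose vertices are joined to \<open>P\<close>: functions constant on it still give the
  multiples of \<open>a\<close>, and all others only give values beyond the largest gap of \<open>S\<close>.\<close>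

section \<open>The Laplacian of a multigraph\<close>

lemma sum_mset_eq_sum_count:
  fixes h :: "'a \<Rightarrow> int"
  shows "(\<Sum>x\<in>#M. h x) = (\<Sum>x\<in>set_mset M. int (count M x) * h x)"
proof (induction M)
  case (add y M)
  show ?case
  proof (cases "y \<in># M")
    case True
    have "(\<Sum>x\<in>set_mset M. int (count (add_mset y M) x) * h x)
        = (\<Sum>x\<in>set_mset M. int (count M x) * h x + (if x = y then h x else 0))"
      by (rule sum.cong) (auto simp: algebra_simps)
    then show ?thesis using True add by (simp add: sum.distrib insert_absorb)
  next
    case False
    have "(\<Sum>x\<in>set_mset M. int (count (add_mset y M) x) * h x)
        = (\<Sum>x\<in>set_mset M. int (count M x) * h x)"
      using False by (intro sum.cong) auto
    then show ?thesis using False add by (simp add: not_in_iff)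
  qed
qed simp

context multigraph
begin

text \<open>Every edge at \<open>Q\<close> is \<open>{Q, R}\<close> for exactly one
  \<open>R\<close>, so these edges can be indexed by the neighbours of \<open>Q\<close>. All other
  \<open>R\<close> in \<open>V\<close>, including \<open>Q\<close> itself, contribute zero.\<close>

lemma laplacian_eq:
  assumes "Q \<in> V"
  shows "laplacian E f Q = (\<Sum>R\<in>V. int (count E {Q, R}) * (f Q - f R))"
proof -
  define h where "h e = (\<Sum>R\<in>e - {Q}. f Q - f R)" for e
  have "laplacian E f Q = (\<Sum>e\<in>{e \<in> set_mset E. Q \<in> e}. int (count E e) * h e)"
    unfolding laplacian_def h_def[symmetric] sum_mset_eq_sum_count by (intro sum.cong) auto
  also have "\<dots> = (\<Sum>R\<in>{R \<in> V. {Q, R} \<in># E}. int (count E {Q, R}) * (f Q - f R))"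
  proof (rule sum.reindex_cong[of "\<lambda>R. {Q, R}"])
    show "inj_on (\<lambda>R. {Q, R}) {R \<in> V. {Q, R} \<in># E}"
      by (auto simp: inj_on_def doubleton_eq_iff)
    show "{e \<in> set_mset E. Q \<in> e} = (\<lambda>R. {Q, R}) ` {R \<in> V. {Q, R} \<in># E}"
    proof (intro equalityI subsetI)
      fix e assume e: "e \<in> {e \<in> set_mset E. Q \<in> e}"
      then obtain R where "e = {Q, R}"
        using edge_endpoints[of e] by (auto simp: card_2_iff)
      then show "e \<in> (\<lambda>R. {Q, R}) ` {R \<in> V. {Q, R} \<in># E}"
        using e edge_endpoints[of e] by auto
    qed auto
    fix R assume "R \<in> {R \<in> V. {Q, R} \<in># E}"
    then have "{Q, R} - {Q} = {R}" using edge_endpoints[of "{Q, R}"] by auto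
    then show "int (count E {Q, R}) * h {Q, R} = int (count E {Q, R}) * (f Q - f R)"
      by (simp add: h_def)
  qed
  also have "\<dots> = (\<Sum>R\<in>V. int (count E {Q, R}) * (f Q - f R))"
    using finite_verts by (intro sum.mono_neutral_left) (auto simp: not_in_iff)
  finally show ?thesis .
qed

lemma laplacian_add:
  assumes "Q \<in> V"
  shows "laplacian E (\<lambda>x. f x + g x) Q = laplacian E f Q + laplacian E g Q"
  unfolding laplacian_eq[OF assms] sum.distrib[symmetric]
  by (rule sum.cong) (simp_all add: algebra_simps)

lemma laplacian_scale:
  assumes "Q \<in> V"
  shows "laplacian E (\<lambda>x. c * f x) Q = c * laplacian E f Q"
  unfolding laplacian_eq[OF assms] sum_distrib_left
  by (rule sum.cong) (simp_all add: algebra_simps)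

lemma laplacian_const:
  assumes "Q \<in> V"
  shows "laplacian E (\<lambda>x. c) Q = 0"
  unfolding laplacian_eq[OF assms] by simp

lemma laplacian_sum:
  assumes "Q \<in> V" "finite A"
  shows "laplacian E (\<lambda>x. \<Sum>i\<in>A. F i x) Q = (\<Sum>i\<in>A. laplacian E (F i) Q)"
  using assms(2)
  by (induction A rule: finite_induct)
    (simp_all add: laplacian_const[OF assms(1)] laplacian_add[OF assms(1)])

lemma laplacian_indicator:
  assumes "Q \<in> V" "A \<in> V" "Q \<noteq> A"
  shows "laplacian E (\<lambda>x. of_bool (x = A)) Q = - int (count E {Q, A})"
proof -
  have "laplacian E (\<lambda>x. of_bool (x = A)) Q
      = (\<Sum>R\<in>V. if R = A then - int (count E {Q, R}) else 0)"
    unfolding laplacian_eq[OF assms(1)] using assms(3) by (intro sum.cong) auto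
  then show ?thesis using assms(2) finite_verts by simp
qed

lemma laplacian_indicator_self:
  assumes "A \<in> V"
  shows "laplacian E (\<lambda>x. of_bool (x = A)) A \<ge> 0"
  unfolding laplacian_eq[OF assms] by (intro sum_nonneg) auto

text \<open>The summand is antisymmetric in \<open>Q\<close> and \<open>R\<close>, so swapping the
  two sums turns the total into its negative.\<close>

lemma sum_laplacian: "(\<Sum>Q\<in>V. laplacian E f Q) = 0"
proof -
  let ?c = "\<lambda>Q R. int (count E {Q, R})"
  have eq: "(\<Sum>Q\<in>V. laplacian E f Q) = (\<Sum>Q\<in>V. \<Sum>R\<in>V. ?c Q R * (f Q - f R))"
    by (rule sum.cong) (simp_all add: laplacian_eq)
  also have "\<dots> = (\<Sum>Q\<in>V. \<Sum>R\<in>V. - (?c Q R * (f Q - f R)))"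
    by (subst sum.swap) (auto simp: insert_commute algebra_simps intro!: sum.cong)
  also have "\<dots> = - (\<Sum>Q\<in>V. laplacian E f Q)"
    unfolding eq by (simp add: sum_negf)
  finally show ?thesis by simp
qed

section \<open>Constraints on the Weierstrass set of a graph\<close>

lemma submonoid_weierstrass_set:
  assumes "P \<in> V"
  shows "additive_submonoid (weierstrass_set V E P)"
  unfolding additive_submonoid_def
proof (intro conjI ballI)
  show "0 \<in> weierstrass_set V E P"
    unfolding weierstrass_set_def using assms
    by (auto intro!: exI[of _ "\<lambda>_. 0"] simp: laplacian_const)
  fix a b assume "a \<in> weierstrass_set V E P" "b \<in> weierstrass_set V E P"
  then obtain f g where
    "laplacian E f P = - int a" "\<forall>Q\<in>V - {P}. laplacian E f Q \<ge> 0"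
    "laplacian E g P = - int b" "\<forall>Q\<in>V - {P}. laplacian E g Q \<ge> 0"
    unfolding weierstrass_set_def by blast
  then have "laplacian E (\<lambda>x. f x + g x) P = - int (a + b)"
    "\<forall>Q\<in>V - {P}. laplacian E (\<lambda>x. f x + g x) Q \<ge> 0"
    using assms by (simp_all add: laplacian_add)
  then show "a + b \<in> weierstrass_set V E P"
    unfolding weierstrass_set_def by blast
qed

text \<open>Subtracting the indicator of \<open>Q\<close> from a large multiple of a function with positive
  Laplacian at \<open>Q\<close> makes the Laplacian positive at the neighbours of \<open>Q\<close>.\<close>

lemma superharmonic_positive_at:
  assumes "P \<in> V" "Q \<in> V"
  shows "\<exists>f. (\<forall>R\<in>V - {P}. laplacian E f R \<ge> 0) \<and> (Q \<noteq> P \<longrightarrow> laplacian E f Q > 0)"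
  using connected[OF assms]
proof (induction rule: rtrancl_induct)
  case base
  show ?case by (rule exI[of _ "\<lambda>_. 0"]) (auto simp: laplacian_const)
next
  case (step Q Q')
  then obtain f where f: "\<forall>R\<in>V - {P}. laplacian E f R \<ge> 0" "Q \<noteq> P \<longrightarrow> laplacian E f Q > 0"
    by blast
  have edge: "{Q, Q'} \<in># E" using step by simp
  then have V: "Q \<in> V" "Q' \<in> V" and ne: "Q \<noteq> Q'" using edge_endpoints[OF edge] by auto
  \<comment> \<open>Positivity is passed along a path from \<open>P\<close>, here from
    \<open>Q\<close> to \<open>Q'\<close>. Subtracting the indicator costs \<open>K\<close> at
    \<open>Q\<close>; if \<open>Q \<noteq> P\<close>, integrality lets \<open>K\<close> copies of
    \<open>f\<close> repay it.\<close>
  define K where "K = laplacian E (\<lambda>x. of_bool (x = Q)) Q"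
  have K: "K \<ge> 0" unfolding K_def by (rule laplacian_indicator_self[OF V(1)])
  define g where "g x = K * f x + (-1) * of_bool (x = Q)" for x
  have g: "laplacian E g R = K * laplacian E f R - laplacian E (\<lambda>x. of_bool (x = Q)) R"
    if "R \<in> V" for R
    unfolding g_def laplacian_add[OF that] laplacian_scale[OF that] by simp
  have "laplacian E g R \<ge> 0" if "R \<in> V - {P}" for R
  proof (cases "R = Q")
    case True
    then have "laplacian E f Q \<ge> 1" using f(2) that by auto
    then have "K * laplacian E f Q \<ge> K * 1" using K by (intro mult_left_mono) auto
    then show ?thesis using True V g[of Q] by (simp add: K_def)
  next
    case False
    then show ?thesis using that V f(1) K by (simp add: g laplacian_indicator)
  qed
  moreover have "laplacian E g Q' > 0" if "Q' \<noteq> P"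
  proof -
    have "int (count E {Q', Q}) > 0" using edge by (simp add: insert_commute)
    moreover have "K * laplacian E f Q' \<ge> 0" using f(1) V K that by simp
    ultimately show ?thesis using V ne
      by (simp add: g laplacian_indicator del: of_nat_0_less_iff)
  qed
  ultimately show ?case by blast
qed

text \<open>Sum the functions just obtained over all \<open>Q\<close>: at \<open>R\<close> none is
  negative and the one chosen for \<open>R\<close> is positive.\<close>

lemma strictly_superharmonic_exists:
  assumes "P \<in> V"
  shows "\<exists>f. \<forall>R\<in>V - {P}. laplacian E f R > 0"
proof -
  have "\<forall>Q\<in>V. \<exists>f. (\<forall>R\<in>V - {P}. laplacian E f R \<ge> 0) \<and> (Q \<noteq> P \<longrightarrow> laplacian E f Q > 0)"
    using superharmonic_positive_at[OF assms] by blast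
  then obtain F where F: "\<forall>Q\<in>V. (\<forall>R\<in>V - {P}. laplacian E (F Q) R \<ge> 0) \<and>
      (Q \<noteq> P \<longrightarrow> laplacian E (F Q) Q > 0)"
    by metis
  have "laplacian E (\<lambda>x. \<Sum>Q\<in>V. F Q x) R > 0" if "R \<in> V - {P}" for R
    using that F finite_verts by (auto simp: laplacian_sum intro!: sum_pos2[of V R])
  then show ?thesis by blast
qed

end

text \<open>For a neighbour \<open>Q\<close> of \<open>P\<close> and a strictly superharmonic \<open>f\<close>, all functions
  \<open>t f + k 1\<^sub>Q\<close> with \<open>0 \<le> k \<le> t\<close> are superharmonic off \<open>P\<close>, because there are no multiple
  edges.\<close>

lemma (in simple_graph) numerical_semigroup_weierstrass_set:
  assumes P: "P \<in> V"
  shows "numerical_semigroup (weierstrass_set V E P)"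
proof -
  obtain A where A: "A \<in> V" "A \<noteq> P"
    using more_than_one_vertex P by (metis card_le_Suc0_iff_eq finite_verts not_le One_nat_def)
  obtain Q where Q: "{P, Q} \<in># E"
    using connected[OF P A(1)] A(2) by (auto elim: converse_rtranclE)
  then have QV: "Q \<in> V" "Q \<noteq> P" using edge_endpoints[OF Q] by auto
  have "count E {P, Q} > 0" using Q by simp
  then have c1: "count E {P, Q} = 1" using no_multiple_edges[of "{P, Q}"] by linarith
  obtain f where f: "\<forall>R\<in>V - {P}. laplacian E f R > 0"
    using strictly_superharmonic_exists[OF P] by blast
  \<comment> \<open>The values sum to zero and are positive off \<open>P\<close>, where at least
    \<open>Q\<close> lies, so the value at \<open>P\<close> is negative.\<close>
  have "laplacian E f P + (\<Sum>R\<in>V - {P}. laplacian E f R) = 0"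
    using sum_laplacian[of f] P finite_verts by (simp add: sum.remove)
  moreover have "(\<Sum>R\<in>V - {P}. laplacian E f R) > 0"
    using f QV finite_verts by (intro sum_pos) auto
  ultimately have "laplacian E f P < 0" by linarith
  define N where "N = nat (- laplacian E f P)"
  have N: "laplacian E f P = - int N" "N > 0"
    using \<open>laplacian E f P < 0\<close> by (simp_all add: N_def)
  \<comment> \<open>From \<open>N * N\<close> on, the quotient by \<open>N\<close> is at least
    \<open>N\<close> and so exceeds the remainder, which gives \<open>k \<le> t\<close>.\<close>
  have "n \<in> weierstrass_set V E P" if n: "n \<ge> N * N" for n
  proof -
    define t k where "t = n div N" and "k = n mod N"
    have "N * N div N \<le> n div N" using n by (rule div_le_mono)
    then have "N \<le> n div N" using N(2) by simp
    then have kt: "k \<le> t" unfolding k_def t_def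
      using N(2) mod_less_divisor[of N n] by linarith
    have nt: "n = t * N + k" by (simp add: t_def k_def)
    define g where "g x = int t * f x + int k * of_bool (x = Q)" for x
    have g: "laplacian E g R = int t * laplacian E f R
        + int k * laplacian E (\<lambda>x. of_bool (x = Q)) R" if "R \<in> V" for R
      unfolding g_def laplacian_add[OF that] laplacian_scale[OF that] by simp
    have "laplacian E g P = - int n"
      using P QV c1 nt by (simp add: g N laplacian_indicator)
    moreover have "laplacian E g R \<ge> 0" if R: "R \<in> V - {P}" for R
    proof (cases "R = Q")
      case True
      then show ?thesis using R f laplacian_indicator_self[OF QV(1)] by (simp add: g less_imp_le)
    next
      case False
      have "int k * int (count E {R, Q}) \<le> int k * 1"
        using no_multiple_edges[of "{R, Q}"] by (intro mult_left_mono) auto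
      also have "\<dots> \<le> int t * 1" using kt by simp
      also have "\<dots> \<le> int t * laplacian E f R" using f R by (intro mult_left_mono) force+
      finally show ?thesis using R QV False by (simp add: g laplacian_indicator)
    qed
    ultimately show ?thesis unfolding weierstrass_set_def by blast
  qed
  then have "- weierstrass_set V E P \<subseteq> {..<N * N}" by (auto simp: not_less[symmetric])
  then have "finite (- weierstrass_set V E P)" by (rule finite_subset) simp
  then show ?thesis
    unfolding numerical_semigroup_def using submonoid_weierstrass_set[OF P] by blast
qed

section \<open>Submonoids of the natural numbers\<close>

lemma additive_submonoid_sum:
  assumes "additive_submonoid S" "\<And>i. i \<in> I \<Longrightarrow> g i \<in> int ` S"
  shows "(\<Sum>i\<in>I. g i) \<in> int ` S"
proof -
  have 0: "0 \<in> int ` S" using assms(1) by (force simp: additive_submonoid_def)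
  have add: "x + y \<in> int ` S" if "x \<in> int ` S" "y \<in> int ` S" for x y
    using that assms(1) by (force simp: additive_submonoid_def simp flip: of_nat_add)
  show ?thesis using assms(2)
    by (induction I rule: infinite_finite_induct) (auto simp: 0 add)
qed

lemma additive_submonoid_mult:
  assumes "additive_submonoid S" "a \<in> S"
  shows "k * a \<in> S"
  using assms by (induction k) (auto simp: additive_submonoid_def)

text \<open>The generators are the elements that are not sums of two positive elements. They are
  pairwise incongruent modulo any positive element of \<open>S\<close>, apart from that element itself.\<close>

lemma additive_submonoid_finitely_generated:
  assumes S: "additive_submonoid S"
  shows "\<exists>G. finite G \<and> G \<subseteq> S - {0} \<and> (\<forall>T. additive_submonoid T \<longrightarrow> G \<subseteq> T \<longrightarrow> S \<subseteq> T)"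
proof -
  define G where "G = {a \<in> S - {0}. \<forall>x\<in>S - {0}. \<forall>y\<in>S - {0}. a \<noteq> x + y}"
  have "finite G"
  proof (cases "S \<subseteq> {0}")
    case True
    then show ?thesis unfolding G_def by (simp add: Diff_eq_empty_iff[THEN iffD2])
  next
    case False
    then obtain m where m: "m \<in> S" "m > 0" by auto
    \<comment> \<open>Congruent generators \<open>a < b\<close> would give
      \<open>b = a + k * m\<close>, a sum of two positive elements of \<open>S\<close>.\<close>
    have less: False if "a \<in> G" "b \<in> G" "a mod m = b mod m" "a < b" for a b
    proof -
      have "m dvd b - a" using that by (metis mod_eq_dvd_iff_nat less_imp_le)
      then obtain k where k: "b - a = k * m" by (auto simp: dvd_def mult.commute)
      then have b: "b = a + k * m" and "k * m \<noteq> 0" using that by linarith+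
      then have "k * m \<in> S - {0}"
        using additive_submonoid_mult[OF S m(1), of k] by simp
      then show False using that b unfolding G_def by blast
    qed
    have "inj_on (\<lambda>a. a mod m) G"
      by (rule inj_onI) (metis less linorder_neqE_nat)
    moreover have "(\<lambda>a. a mod m) ` G \<subseteq> {..<m}" using m by auto
    ultimately show ?thesis by (meson finite_imageD finite_lessThan finite_subset)
  qed
  moreover have "S \<subseteq> T" if T: "additive_submonoid T" "G \<subseteq> T" for T
  proof
    fix s assume "s \<in> S"
    then show "s \<in> T"
    proof (induction s rule: less_induct)
      case (less s)
      show ?case
      proof (cases "s = 0 \<or> s \<in> G")
        case True
        then show ?thesis using T by (auto simp: additive_submonoid_def)
      next
        case False
        then obtain x y where "x \<in> S - {0}" "y \<in> S - {0}" "s = x + y"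
          using less.prems unfolding G_def by blast
        then show ?thesis using less.IH[of x] less.IH[of y] T by (auto simp: additive_submonoid_def)
      qed
    qed
  qed
  ultimately show ?thesis unfolding G_def by (intro exI[of _ G]) (auto simp: G_def)
qed

section \<open>Block graphs\<close>

text \<open>The vertices other than \<open>P\<close> are partitioned into the fibres of \<open>b\<close>, each of which is a
  complete graph, and \<open>u\<close> is joined to \<open>P\<close> by \<open>q u\<close> edges.\<close>

definition block_weight :: "'v \<Rightarrow> ('v \<Rightarrow> 'b) \<Rightarrow> ('v \<Rightarrow> nat) \<Rightarrow> 'v set \<Rightarrow> nat" where
  "block_weight P b q e = (if P \<in> e then sum q (e - {P}) else of_bool (card (b ` e) = 1))"

definition block_edges ::
    "'v set \<Rightarrow> 'v \<Rightarrow> ('v \<Rightarrow> 'b) \<Rightarrow> ('v \<Rightarrow> nat) \<Rightarrow> 'v set multiset" where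
  "block_edges V P b q =
     (\<Sum>e\<in>{e. e \<subseteq> V \<and> card e = 2}. replicate_mset (block_weight P b q e) e)"

text \<open>\<open>block_joined\<close> ensures connectedness: any vertex is in the clique of some
  vertex joined to \<open>P\<close>.\<close>

locale block_graph =
  fixes V :: "'v set" and P :: 'v and b :: "'v \<Rightarrow> 'b" and q :: "'v \<Rightarrow> nat"
  assumes finite_V: "finite V" and P_in_V: "P \<in> V"
    and block_joined: "x \<in> V - {P} \<Longrightarrow> \<exists>u\<in>V - {P}. b u = b x \<and> q u > 0"
begin

lemma count_block_edges:
  "count (block_edges V P b q) e = (if e \<subseteq> V \<and> card e = 2 then block_weight P b q e else 0)"
proof -
  have "finite {e. e \<subseteq> V \<and> card e = 2}" using finite_V by simp
  then show ?thesis unfolding block_edges_def by (simp add: count_sum sum.delta)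
qed

lemma count_block_edges_P:
  "u \<in> V - {P} \<Longrightarrow> count (block_edges V P b q) {P, u} = q u"
  using P_in_V by (auto simp: count_block_edges block_weight_def)

lemma count_block_edges_block:
  "u \<in> V - {P} \<Longrightarrow> w \<in> V - {P} \<Longrightarrow> u \<noteq> w \<Longrightarrow>
    count (block_edges V P b q) {u, w} = of_bool (b u = b w)"
  by (auto simp: count_block_edges block_weight_def card_insert_if)

lemma P_to_vertex:
  assumes "x \<in> V"
  shows "(P, x) \<in> {(x, y). {x, y} \<in># block_edges V P b q}\<^sup>*"
proof (cases "x = P")
  case False
  then obtain u where u: "u \<in> V - {P}" "b u = b x" "q u > 0" using block_joined assms by blast
  have "{P, u} \<in># block_edges V P b q"
    using u count_block_edges_P[of u] by (simp flip: count_greater_zero_iff)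
  moreover have "{u, x} \<in># block_edges V P b q" if "u \<noteq> x"
    using u that False assms count_block_edges_block[of u x] by (simp flip: count_greater_zero_iff)
  ultimately show ?thesis by (cases "u = x") (auto intro: converse_rtrancl_into_rtrancl)
qed simp

sublocale multigraph V "block_edges V P b q"
proof
  let ?r = "{(x, y). {x, y} \<in># block_edges V P b q}"
  show "finite V" "V \<noteq> {}" using finite_V P_in_V by auto
  show "e \<subseteq> V \<and> card e = 2" if "e \<in># block_edges V P b q" for e
    using that count_block_edges[of e] by (metis count_eq_zero_iff)
  fix u w assume uw: "u \<in> V" "w \<in> V"
  have "sym ?r" by (auto simp: sym_def insert_commute)
  then have "(u, P) \<in> ?r\<^sup>*" using P_to_vertex[OF uw(1)] by (meson sym_rtrancl symD)
  then show "(u, w) \<in> ?r\<^sup>*" using P_to_vertex[OF uw(2)] by (rule rtrancl_trans)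
qed

lemma laplacian_P:
  "laplacian (block_edges V P b q) f P = - (\<Sum>u\<in>V - {P}. int (q u) * (f u - f P))"
proof -
  have "laplacian (block_edges V P b q) f P
      = (\<Sum>u\<in>V - {P}. int (count (block_edges V P b q) {P, u}) * (f P - f u))"
    unfolding laplacian_eq[OF P_in_V] using P_in_V finite_V by (simp add: sum.remove)
  also have "\<dots> = (\<Sum>u\<in>V - {P}. - (int (q u) * (f u - f P)))"
    by (rule sum.cong) (simp_all add: count_block_edges_P algebra_simps)
  finally show ?thesis by (simp add: sum_negf)
qed

text \<open>The last sum includes \<open>w = u\<close>, whose term is zero, so that its index set
  depends on the block alone.\<close>

lemma laplacian_block:
  assumes u: "u \<in> V - {P}"
  shows "laplacian (block_edges V P b q) f u
    = int (q u) * (f u - f P) + (\<Sum>w\<in>{w \<in> V - {P}. b w = b u}. f u - f w)"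
proof -
  have "laplacian (block_edges V P b q) f u = int (q u) * (f u - f P)
      + (\<Sum>w\<in>V - {P}. int (count (block_edges V P b q) {u, w}) * (f u - f w))"
    using u P_in_V finite_V
    by (simp add: laplacian_eq sum.remove[of V P] count_block_edges_P[OF u] insert_commute[of u P])
  also have "(\<Sum>w\<in>V - {P}. int (count (block_edges V P b q) {u, w}) * (f u - f w))
      = (\<Sum>w\<in>V - {P}. if b w = b u then f u - f w else 0)"
  proof (rule sum.cong)
    fix w assume "w \<in> V - {P}"
    then show "int (count (block_edges V P b q) {u, w}) * (f u - f w)
      = (if b w = b u then f u - f w else 0)"
      using count_block_edges_block[OF u, of w] by (cases "u = w") auto
  qed simp
  also have "\<dots> = (\<Sum>w\<in>{w \<in> V - {P}. b w = b u}. f u - f w)"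
    using finite_V by (intro sum.inter_filter[symmetric]) auto
  finally show ?thesis .
qed

text \<open>No edge joins two blocks. After subtracting \<open>f P\<close>, the sign conditions
  therefore concern one block at a time, and the value at \<open>P\<close> splits into block
  contributions that can be tested separately.\<close>

lemma weierstrass_set_subset:
  assumes S: "additive_submonoid S"
    and local: "\<And>x g. x \<in> V - {P} \<Longrightarrow>
      (\<And>u. u \<in> V - {P} \<Longrightarrow> b u = b x \<Longrightarrow>
        int (q u) * g u + (\<Sum>w\<in>{w \<in> V - {P}. b w = b x}. g u - g w) \<ge> 0) \<Longrightarrow>
      (\<Sum>u\<in>{u \<in> V - {P}. b u = b x}. int (q u) * g u) \<in> int ` S"
  shows "weierstrass_set V (block_edges V P b q) P \<subseteq> S"
proof
  fix n assume "n \<in> weierstrass_set V (block_edges V P b q) P"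
  then obtain f where f: "laplacian (block_edges V P b q) f P = - int n"
    "\<forall>Q\<in>V - {P}. laplacian (block_edges V P b q) f Q \<ge> 0"
    unfolding weierstrass_set_def by blast
  define g where "g u = f u - f P" for u
  have "int n = (\<Sum>u\<in>V - {P}. int (q u) * g u)"
    using f(1) by (simp add: laplacian_P g_def)
  also have "\<dots> = (\<Sum>y\<in>b ` (V - {P}). \<Sum>u\<in>{u \<in> V - {P}. b u = y}. int (q u) * g u)"
    using finite_V by (intro sum.image_gen) auto
  also have "\<dots> \<in> int ` S"
  proof (rule additive_submonoid_sum[OF S])
    fix y assume "y \<in> b ` (V - {P})"
    then obtain x where x: "x \<in> V - {P}" "y = b x" by blast
    show "(\<Sum>u\<in>{u \<in> V - {P}. b u = y}. int (q u) * g u) \<in> int ` S"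
      unfolding x(2)
    proof (rule local[OF x(1)])
      fix u assume u: "u \<in> V - {P}" "b u = b x"
      have "laplacian (block_edges V P b q) f u \<ge> 0" using f(2) u(1) by blast
      then show "int (q u) * g u + (\<Sum>w\<in>{w \<in> V - {P}. b w = b x}. g u - g w) \<ge> 0"
        unfolding laplacian_block[OF u(1)] u(2) g_def by (simp add: algebra_simps)
    qed
  qed
  finally show "n \<in> S" by auto
qed

text \<open>The witness is the indicator of the block: it is constant along inner edges, so only the
  edges to \<open>P\<close> count.\<close>

lemma block_valency_in_weierstrass_set:
  "(\<Sum>u\<in>{u \<in> V - {P}. b u = y}. q u) \<in> weierstrass_set V (block_edges V P b q) P"
proof -
  define f :: "'v \<Rightarrow> int" where "f u = of_bool (u \<noteq> P \<and> b u = y)" for u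
  have "laplacian (block_edges V P b q) f P
      = - (\<Sum>u\<in>V - {P}. if b u = y then int (q u) else 0)"
    unfolding laplacian_P f_def by (intro arg_cong[of _ _ uminus] sum.cong) auto
  also have "\<dots> = - int (\<Sum>u\<in>{u \<in> V - {P}. b u = y}. q u)"
    unfolding of_nat_sum using finite_V by (subst sum.inter_filter) auto
  finally have "laplacian (block_edges V P b q) f P = \<dots>" .
  moreover have "laplacian (block_edges V P b q) f u \<ge> 0" if "u \<in> V - {P}" for u
    unfolding laplacian_block[OF that] using that
    by (auto simp: f_def intro!: add_nonneg_nonneg sum_nonneg)
  ultimately show ?thesis unfolding weierstrass_set_def by blast
qed

end

section \<open>Realizing a submonoid\<close>

text \<open>Each generator \<open>a\<close> gets a clique on \<open>m\<close> vertices, the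
  \<open>j\<close>-th joined to \<open>P\<close> by \<open>p a j\<close> edges. Block indicators put
  \<open>G\<close>, hence by \<open>gen\<close> all of \<open>S\<close>, into the Weierstrass set;
  \<open>local\<close> gives the reverse inclusion.\<close>

lemma ex_block_graph:
  fixes S G :: "nat set" and m :: nat and p :: "nat \<Rightarrow> nat \<Rightarrow> nat"
  assumes S: "additive_submonoid S" and G: "finite G"
    and gen: "\<And>T. additive_submonoid T \<Longrightarrow> G \<subseteq> T \<Longrightarrow> S \<subseteq> T"
    and p: "\<And>a. a \<in> G \<Longrightarrow> (\<Sum>j<m. p a j) = a" "\<And>a. a \<in> G \<Longrightarrow> \<exists>j<m. p a j > 0"
    and local: "\<And>a g. a \<in> G \<Longrightarrow>
      (\<And>j. j < m \<Longrightarrow> int (p a j) * g j + (\<Sum>i<m. g j - g i) \<ge> 0) \<Longrightarrow>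
      (\<Sum>j<m. int (p a j) * g j) \<in> int ` S"
  shows "\<exists>(V :: 'v::infinite set) E P. multigraph V E \<and> P \<in> V \<and> S = weierstrass_set V E P \<and>
    card V = card G * m + 1 \<and> ((\<forall>a j. p a j \<le> 1) \<longrightarrow> (\<forall>e. count E e \<le> 1))"
proof -
  obtain h :: "nat \<Rightarrow> 'v" where h: "inj h"
    using infinite_countable_subset[OF infinite_UNIV] by blast
  define P where "P = h 0"
  \<comment> \<open>\<open>Suc\<close> keeps these vertices distinct from
    \<open>P = h 0\<close>.\<close>
  define v where "v a j = h (Suc (prod_encode (a, j)))" for a j
  have v_eq: "v a j = v a' j' \<longleftrightarrow> a = a' \<and> j = j'" for a j a' j'
    using h by (auto simp: v_def inj_eq prod_encode_eq)
  have vP: "v a j \<noteq> P" for a j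
    using h by (auto simp: v_def P_def inj_eq)
  define V where "V = insert P ((\<lambda>(a, j). v a j) ` (G \<times> {..<m}))"
  define b where "b u = (THE a. \<exists>j. u = v a j)" for u
  define q where "q u = (THE n. \<exists>a j. u = v a j \<and> n = p a j)" for u
  have b: "b (v a j) = a" and q: "q (v a j) = p a j" for a j
    unfolding b_def q_def by (auto simp: v_eq)
  have VP: "V - {P} = (\<lambda>(a, j). v a j) ` (G \<times> {..<m})"
    unfolding V_def using vP by auto
  have blk: "{u \<in> V - {P}. b u = a} = v a ` {..<m}" if "a \<in> G" for a
    unfolding VP using that by (auto simp: b)
  have inj: "inj_on (v a) {..<m}" for a by (auto simp: inj_on_def v_eq)
  interpret block_graph V P b q
  proof
    show "finite V" "P \<in> V" using G by (auto simp: V_def)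
    fix x assume "x \<in> V - {P}"
    then obtain a j where x: "x = v a j" "a \<in> G" unfolding VP by auto
    then obtain i where "i < m" "p a i > 0" using p(2) by blast
    then show "\<exists>u\<in>V - {P}. b u = b x \<and> q u > 0"
      using x unfolding VP by (auto simp: b q intro!: bexI[of _ "(a, i)"])
  qed
  let ?E = "block_edges V P b q"
  have "weierstrass_set V ?E P \<subseteq> S"
  proof (rule weierstrass_set_subset[OF S])
    fix x g assume x: "x \<in> V - {P}" and nonneg: "\<And>u. u \<in> V - {P} \<Longrightarrow> b u = b x \<Longrightarrow>
        int (q u) * g u + (\<Sum>w\<in>{w \<in> V - {P}. b w = b x}. g u - g w) \<ge> 0"
    obtain a k where a: "x = v a k" "a \<in> G" using x unfolding VP by auto
    have "int (p a j) * g (v a j) + (\<Sum>i<m. g (v a j) - g (v a i)) \<ge> 0" if "j < m" for j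
      using nonneg[of "v a j"] a that blk[OF a(2)]
      unfolding VP by (auto simp: b q sum.reindex[OF inj])
    from local[OF a(2) this]
    show "(\<Sum>u\<in>{u \<in> V - {P}. b u = b x}. int (q u) * g u) \<in> int ` S"
      unfolding a(1) b blk[OF a(2)] by (simp add: sum.reindex[OF inj] q)
  qed
  moreover have "G \<subseteq> weierstrass_set V ?E P"
  proof
    fix a assume a: "a \<in> G"
    have "(\<Sum>u\<in>{u \<in> V - {P}. b u = a}. q u) = a"
      unfolding blk[OF a] by (simp add: sum.reindex[OF inj] q p(1)[OF a])
    then show "a \<in> weierstrass_set V ?E P" using block_valency_in_weierstrass_set[of a] by simp
  qed
  then have "S \<subseteq> weierstrass_set V ?E P"
    using gen submonoid_weierstrass_set[OF P_in_V] by blast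
  moreover have "card V = card G * m + 1"
  proof -
    have "inj_on (\<lambda>(a, j). v a j) (G \<times> {..<m})" by (auto simp: inj_on_def v_eq)
    then have "card (V - {P}) = card G * m" unfolding VP by (simp add: card_image card_cartesian_product)
    then show ?thesis using card_Suc_Diff1[OF finite_V P_in_V] by simp
  qed
  \<comment> \<open>Edges at \<open>P\<close> have a value of \<open>p\<close> as multiplicity;
    edges inside a block are simple by construction.\<close>
  moreover have "count ?E e \<le> 1" if p1: "\<forall>a j. p a j \<le> 1" for e
  proof (cases "e \<in># ?E \<and> P \<in> e")
    case True
    then obtain u where "e = {P, u}" "u \<in> V - {P}"
      using edge_endpoints[of e] by (auto simp: card_2_iff doubleton_eq_iff)
    moreover have "q u \<le> 1" if "u \<in> V - {P}" for u
      using that p1 unfolding VP by (auto simp: q)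
    ultimately show ?thesis by (simp add: count_block_edges_P)
  next
    case False
    then show ?thesis
      by (cases "e \<in># ?E") (auto simp: count_block_edges block_weight_def not_in_iff)
  qed
  ultimately show ?thesis
    using multigraph_axioms P_in_V by (intro exI[of _ V] exI[of _ ?E] exI[of _ P]) auto
qed

text \<open>At a vertex of a complete graph not joined to \<open>P\<close>, a superharmonic function takes at least
  its average value, so it exceeds the minimum unless the function is constant. With few
  vertices joined to \<open>P\<close> this forces the minimum to be large.\<close>

lemma clique_superharmonic:
  fixes g :: "nat \<Rightarrow> int"
  assumes a: "0 < a" "a + c \<le> m"
    and g: "\<And>j. j < m \<Longrightarrow> int (of_bool (j < a)) * g j + (\<Sum>i<m. g j - g i) \<ge> 0"
  shows "(\<exists>k\<ge>0. (\<Sum>j<a. g j) = int a * k) \<or> (\<Sum>j<a. g j) \<ge> int c"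
proof -
  define T where "T = (\<Sum>i<m. g i)"
  define \<mu> where "\<mu> = Min (g ` {..<m})"
  have m: "m > 0" using a by simp
  have le: "\<mu> \<le> g j" if "j < m" for j unfolding \<mu>_def using that by simp
  have "\<mu> \<in> g ` {..<m}" unfolding \<mu>_def using m by (intro Min_in) auto
  then obtain j0 where j0: "j0 < m" "g j0 = \<mu>" by auto
  \<comment> \<open>The clique part equals \<open>m * g j - T\<close>, so the condition compares
    \<open>g j\<close> with the average of \<open>g\<close>.\<close>
  have gT: "of_bool (j < a) * g j + int m * g j \<ge> T" if "j < m" for j
    using g[OF that] by (simp add: sum_subtractf T_def)
  have Tm: "T \<ge> int m * \<mu>"
    unfolding T_def using sum_bounded_below[of "{..<m}" \<mu> g] le by simp
  show ?thesis
  proof (cases "T = int m * \<mu>")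
    case True
    then have "(\<Sum>i<m. g i - \<mu>) = 0" by (simp add: sum_subtractf T_def)
    then have const: "g j = \<mu>" if "j < m" for j
      using that le by (subst (asm) sum_nonneg_eq_0_iff) auto
    \<comment> \<open>Vertex \<open>0\<close> is joined to \<open>P\<close>; as the clique part
      vanishes there, the condition becomes \<open>\<mu> \<ge> 0\<close>.\<close>
    have "\<mu> \<ge> 0" using gT[of 0] m a True by (simp add: const)
    moreover have "(\<Sum>j<a. g j) = int a * \<mu>" using a by (simp add: const)
    ultimately show ?thesis by blast
  next
    case False
    then have Tl: "T > int m * \<mu>" using Tm by simp
    have big: "g j \<ge> \<mu> + 1" if "a \<le> j" "j < m" for j
    proof -
      have "T \<le> int m * g j" using gT[of j] that by simp
      then have "int m * \<mu> < int m * g j" using Tl by linarith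
      then have "\<mu> < g j" by (rule mult_left_less_imp_less) simp
      then show ?thesis by simp
    qed
    have j0a: "j0 < a" using big[of j0] j0 by linarith
    \<comment> \<open>The \<open>m - a\<close> vertices not joined to \<open>P\<close> all exceed
      the minimum. Since the condition at \<open>j0\<close> reads
      \<open>(m + 1) * \<mu> \<ge> T\<close>, it follows that
      \<open>\<mu> \<ge> m - a \<ge> c\<close>.\<close>
    have "T \<ge> (\<Sum>j<m. \<mu> + of_bool (a \<le> j))"
      unfolding T_def using big le by (intro sum_mono) auto
    moreover have "(\<Sum>j<m. (of_bool (a \<le> j) :: int)) = int (m - a)"
    proof -
      have "{j. j < m \<and> a \<le> j} = {a..<m}" by auto
      then show ?thesis by (simp add: sum.inter_filter[symmetric] of_bool_def)
    qed
    ultimately have "T \<ge> int m * \<mu> + int (m - a)" by (simp add: sum.distrib)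
    then have mu: "\<mu> \<ge> int c" using gT[OF j0(1)] j0 j0a a by simp
    have "int c \<le> int a * \<mu>"
      using mult_mono[of 1 "int a" "int c" \<mu>] mu a by simp
    also have "\<dots> \<le> (\<Sum>j<a. g j)"
      using sum_bounded_below[of "{..<a}" \<mu> g] le a by simp
    finally show ?thesis by blast
  qed
qed

section \<open>Realizations by multigraphs and by simple graphs\<close>

lemma multigraph_realization:
  assumes S: "additive_submonoid S"
  shows "\<exists>(V :: 'v::infinite set) E P. multigraph V E \<and> P \<in> V \<and> S = weierstrass_set V E P"
proof -
  obtain G where G: "finite G" "G \<subseteq> S - {0}"
    "\<And>T. additive_submonoid T \<Longrightarrow> G \<subseteq> T \<Longrightarrow> S \<subseteq> T"
    using additive_submonoid_finitely_generated[OF S] by blast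
  \<comment> \<open>This is \<open>ex_block_graph\<close> with \<open>m = 1\<close> and
    \<open>p a j = a\<close>: every block is a single vertex.\<close>
  have "\<exists>(V :: 'v set) E P. multigraph V E \<and> P \<in> V \<and> S = weierstrass_set V E P \<and>
    card V = card G * 1 + 1 \<and> ((\<forall>a (j :: nat). a \<le> (1 :: nat)) \<longrightarrow> (\<forall>e. count E e \<le> 1))"
  proof (rule ex_block_graph[OF S G(1) G(3)])
    fix a and g :: "nat \<Rightarrow> int" assume a: "a \<in> G"
      and g: "\<And>j. j < 1 \<Longrightarrow> int a * g j + (\<Sum>i<1. g j - g i) \<ge> 0"
    have "a > 0" using a G(2) by auto
    then have "g 0 \<ge> 0" using g[of 0] by (simp add: zero_le_mult_iff)
    then have "int a * g 0 = int (nat (g 0) * a)" by simp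
    moreover have "nat (g 0) * a \<in> S"
      using a G(2) by (intro additive_submonoid_mult[OF S]) auto
    ultimately have "int a * g 0 \<in> int ` S" by (metis imageI)
    then show "(\<Sum>j<1. int a * g j) \<in> int ` S" by simp
  qed (use G(2) in auto)
  then show ?thesis by blast
qed

lemma simple_graph_realization:
  assumes "numerical_semigroup S"
  shows "\<exists>(V :: 'v::infinite set) E P. simple_graph V E \<and> P \<in> V \<and> S = weierstrass_set V E P"
proof -
  have S: "additive_submonoid S" and fin: "finite (- S)"
    using assms by (auto simp: numerical_semigroup_def)
  obtain c where c: "\<And>n. n \<ge> c \<Longrightarrow> n \<in> S"
    using fin by (metis ComplI finite_nat_set_iff_bounded not_le)
  obtain G where G: "finite G" "G \<subseteq> S - {0}"
    "\<And>T. additive_submonoid T \<Longrightarrow> G \<subseteq> T \<Longrightarrow> S \<subseteq> T"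
    using additive_submonoid_finitely_generated[OF S] by blast
  \<comment> \<open>This will provide a vertex other than \<open>P\<close>.\<close>
  have "G \<noteq> {}"
  proof
    assume "G = {}"
    then have "S \<subseteq> {0}" using G(3)[of "{0}"] by (simp add: additive_submonoid_def)
    then show False using c[of "Suc c"] by auto
  qed
  \<comment> \<open>One clique size serves all generators: \<open>a + c \<le> m\<close> is what
    \<open>clique_superharmonic\<close> requires.\<close>
  define m where "m = \<Sum>G + c"
  have m: "a + c \<le> m" if "a \<in> G" for a
    unfolding m_def using member_le_sum[of a G "\<lambda>x. x"] that G(1) by simp
  have pos: "a > 0" if "a \<in> G" for a using that G(2) by auto
  have sum_eq: "(\<Sum>j<m. of_bool (j < a) * g j) = (\<Sum>j<a. g j)" if "a \<in> G"
    for a and g :: "nat \<Rightarrow> 'a::semiring_1"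
  proof -
    have "{..<m} \<inter> {j. j < a} = {..<a}" using m[OF that] by auto
    then show ?thesis by (simp add: of_bool_def if_distrib[of "\<lambda>x. x * _"] sum.If_cases cong: if_cong)
  qed
  \<comment> \<open>This is \<open>ex_block_graph\<close> with
    \<open>p a j = of_bool (j < a)\<close>: single edges join \<open>P\<close> to the first
    \<open>a\<close> vertices of each clique.\<close>
  have "\<exists>(V :: 'v set) E P. multigraph V E \<and> P \<in> V \<and> S = weierstrass_set V E P \<and>
    card V = card G * m + 1 \<and>
    ((\<forall>a j :: nat. of_bool (j < a) \<le> (1 :: nat)) \<longrightarrow> (\<forall>e. count E e \<le> 1))"
  proof (rule ex_block_graph[OF S G(1) G(3)])
    fix a assume a: "a \<in> G"
    show "(\<Sum>j<m. of_bool (j < a)) = a"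
      using sum_eq[OF a, of "\<lambda>_. 1 :: nat"] by simp
    show "\<exists>j<m. of_bool (j < a) > (0 :: nat)"
      using pos[OF a] m[OF a] by (intro exI[of _ 0]) auto
    fix g :: "nat \<Rightarrow> int"
    assume g: "\<And>j. j < m \<Longrightarrow> int (of_bool (j < a)) * g j + (\<Sum>i<m. g j - g i) \<ge> 0"
    have eq: "(\<Sum>j<m. int (of_bool (j < a)) * g j) = (\<Sum>j<a. g j)"
      using sum_eq[OF a, of g] by simp
    \<comment> \<open>A block contributes either a multiple of its generator or a value beyond all
      gaps of \<open>S\<close>.\<close>
    consider k where "k \<ge> 0" "(\<Sum>j<a. g j) = int a * k" | "(\<Sum>j<a. g j) \<ge> int c"
      using clique_superharmonic[OF pos[OF a] m[OF a] g] by blast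
    then show "(\<Sum>j<m. int (of_bool (j < a)) * g j) \<in> int ` S"
      unfolding eq
    proof cases
      case 1
      then have "(\<Sum>j<a. g j) = int (nat k * a)" by simp
      moreover have "nat k * a \<in> S"
        using a G(2) by (intro additive_submonoid_mult[OF S]) auto
      ultimately show "(\<Sum>j<a. g j) \<in> int ` S" by (metis imageI)
    next
      case 2
      then have "(\<Sum>j<a. g j) = int (nat (\<Sum>j<a. g j))" "nat (\<Sum>j<a. g j) \<ge> c" by linarith+
      then show "(\<Sum>j<a. g j) \<in> int ` S" using c by (metis imageI)
    qed
  qed
  then obtain V :: "'v set" and E P where VE: "multigraph V E" "P \<in> V" "S = weierstrass_set V E P"
    "card V = card G * m + 1" "\<forall>e. count E e \<le> 1"
    by auto
  have "card G > 0" "m > 0" using \<open>G \<noteq> {}\<close> G(1) m pos by (auto simp: card_gt_0_iff)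
  then have "card V > 1" using VE(4) by simp
  then have "simple_graph V E"
    using VE by (simp add: simple_graph_def simple_graph_axioms_def)
  then show ?thesis using VE by blast
qed

theorem theoremB:
  fixes S :: "nat set"
  shows "((\<exists>(V :: 'v::infinite set) E P. multigraph V E \<and> P \<in> V \<and> S = weierstrass_set V E P)
            \<longleftrightarrow> additive_submonoid S) \<and>
         ((\<exists>(V :: 'v::infinite set) E P. simple_graph V E \<and> P \<in> V \<and> S = weierstrass_set V E P)
            \<longleftrightarrow> numerical_semigroup S)"
  using multigraph_realization simple_graph_realization
    multigraph.submonoid_weierstrass_set simple_graph.numerical_semigroup_weierstrass_set
  by metis

end
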